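(* Let $p$ be a prime. (i) If $p\equiv 3\pmod 4$, then $$\sum_{k=0}^{p-1}\binom{p-1}{k}\binom{2k}{k}^2\frac{1}{(-8)^k}\equiv 0\pmod{p^2}.$$ (ii) If $p\equiv 1\pmod{12}$, then $$\sum_{k=0}^{p-1}\binom{p-1}{k}\binom{2k}{k}^2\frac{\chi_3(k)}{16^k}\equiv 0\pmod{p^2}.$$ (iii) If $p\equiv 7\pmod 8$, then $$\sum_{k=0}^{p-1}\binom{p-1}{k}\binom{2k}{k}^2\frac{P_k}{8^k}\equiv 0\pmod{p^2},$$ where $P_0=0$, $P_1=1$, and $P_n=2P_{n-1}+P_{n-2}$ for $n\ge 2$ (the Pell numbers). (iv) If $p\equiv 11\pmod{12}$, then $$\sum_{k=0}^{p-1}\binom{p-1}{k}\binom{2k}{k}^2\frac{R_k}{(-4)^k}\equiv 0\pmod{p^2},$$ where $R_0=2$, $R_1=4$, and $R_n=4R_{n-1}-R_{n-2}$ for $n\ge 2$.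
   Context: $\chi_3(k)=\left(\frac{k}{3}\right)$ is the Legendre symbol modulo $3$: $\chi_3(k)=0,1,-1$ according as $k\equiv 0,1,2\pmod 3$. Congruences are between rational numbers whose denominators are prime to $p$: for such $r,s$, $r\equiv s\pmod{p^2}$ means that the numerator of $r-s$ in lowest terms is divisible by $p^2$. *)

theory Defs
  imports Complex_Main "HOL-Number_Theory.Number_Theory"
begin

text \<open>
  \<open>quotient_of r = (a, b)\<close> gives the representation of the rational number \<open>r\<close> in lowest
  terms with \<open>b > 0\<close>.
\<close>

definition denom_prime_to :: "nat \<Rightarrow> rat \<Rightarrow> bool" where
  "denom_prime_to p r \<longleftrightarrow> coprime (snd (quotient_of r)) (int p)"

text \<open>
  The congruence modulo \<open>p\<^sup>2\<close> is only meaningful for rational numbers whose denominators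
  are prime to \<open>p\<close>; the relation is false for all others.
\<close>

definition rat_cong_sq :: "nat \<Rightarrow> rat \<Rightarrow> rat \<Rightarrow> bool" where
  "rat_cong_sq p r s \<longleftrightarrow>
     denom_prime_to p r \<and> denom_prime_to p s \<and> int p ^ 2 dvd fst (quotient_of (r - s))"

definition chi3 :: "nat \<Rightarrow> int" where
  "chi3 k = Legendre (int k) 3"

fun pell :: "nat \<Rightarrow> int" where
  "pell 0 = 0"
| "pell (Suc 0) = 1"
| "pell (Suc (Suc n)) = 2 * pell (Suc n) + pell n"

fun R_seq :: "nat \<Rightarrow> int" where
  "R_seq 0 = 2"
| "R_seq (Suc 0) = 4"
| "R_seq (Suc (Suc n)) = 4 * R_seq (Suc n) - R_seq n"

end

theory Submission
  imports Defs "HOL-Computational_Algebra.Polynomial" "HOL-Computational_Algebra.Formal_Power_Series"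
begin

text \<open>
  Let \<open>p = 2n + 1\<close>. Modulo \<open>p\<^sup>2\<close> and up to a unit, the coefficient
  \<open>C(p-1,k) C(2k,k)\<^sup>2\<close> equals \<open>16\<^sup>k C(n,k) e\<^sub>k\<close> with
  \<open>e\<^sub>k = (n+1)\<^sub>k / (2n+2)\<^sub>k\<close>, and the sequence \<open>e\<close> is its own binomial transform by
  Chu--Vandermonde. Hence \<open>G(y) = \<Sum>\<^sub>k C(n,k) e\<^sub>k y\<^sup>k\<close> satisfies
  \<open>G(y) = (1+y)\<^sup>n G(z)\<close> exactly whenever \<open>(1+y)(1+z) = 1\<close>. The four sums are
  \<open>G(-2)\<close>, and combinations of \<open>G(y)\<close> and \<open>G(z)\<close> for
  \<open>y = \<omega>\<close>, \<open>y = 2(1+\<surd>2)\<close> and \<open>y = -4(2+\<surd>3)\<close>. The first two vanish outright.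
  In the other two \<open>1+y\<close> is up to sign the square of a unit \<open>\<epsilon>\<close>, and the sum becomes
  \<open>\<plusminus>(\<epsilon>\<^bsup>p-1\<^esup> - 1) G(z)\<close>, where both factors are divisible by \<open>p\<close>: the first
  because \<open>2\<close> (resp. \<open>3\<close>) is a square modulo \<open>p\<close>, the second because modulo \<open>p\<close> the form
  \<open>G\<close> is the Hasse polynomial \<open>\<Sum>\<^sub>k C(n,k)\<^sup>2 \<lambda>\<^sup>k\<close> of the Legendre family at \<open>\<lambda> = -z\<close>,
  whose vanishing follows from the symmetries \<open>\<lambda> \<mapsto> 1/\<lambda>\<close>,
  \<open>\<lambda> \<mapsto> \<lambda>/(\<lambda>-1)\<close> and Landen's transformation.
\<close>

section \<open>Exact identities: self-dual coefficients, the form G, Landen's transformation\<close>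

text \<open>
  This is \<open>(2n+2)\<^sub>n\<close> times \<open>(n+1)\<^sub>k / (2n+2)\<^sub>k\<close>, which clears all denominators.
\<close>

definition E_coeff :: "nat \<Rightarrow> nat \<Rightarrow> int" where
  "E_coeff n k = pochhammer (of_nat n + 1) k * pochhammer (2 * of_nat n + 2 + of_nat k) (n - k)"

lemma pochhammer_uminus_of_nat:
  "pochhammer (- of_nat j :: 'a::field_char_0) k / fact k = (-1) ^ k * of_nat (j choose k)"
  by (simp add: binomial_gbinomial gbinomial_pochhammer flip: power_mult_distrib mult.assoc)

text \<open>Chu-Vandermonde with a = n + 1 and c = 2n + 2 sums the left side to a multiple of
  \<open>pochhammer (c - a) j / pochhammer c j\<close>; self-duality is the coincidence
  \<open>c - a = a\<close>.\<close>

lemma E_coeff_binomial_transform: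
  assumes "j \<le> n"
  shows "(\<Sum>k\<le>j. of_nat (j choose k) * (-1) ^ k * E_coeff n k) = E_coeff n j"
proof -
  define a c :: rat where "a = of_nat n + 1" and "c = 2 * of_nat n + 2"
  have nz: "pochhammer c m \<noteq> 0" for m
    unfolding c_def using pochhammer_pos[of "2 * of_nat n + 2 :: rat" m] by simp
  have E: "of_int (E_coeff n k) = pochhammer c n * (pochhammer a k / pochhammer c k)"
    if "k \<le> n" for k
  proof -
    have "of_int (E_coeff n k) = pochhammer a k * pochhammer (c + of_nat k) (n - k)"
      by (simp add: E_coeff_def a_def c_def flip: pochhammer_of_int)
    then show ?thesis
      using pochhammer_product[OF that, of c] nz by simp
  qed
  have cc: "\<forall>i\<in>{0..<j}. c \<noteq> - of_nat i"
  proof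
    fix i assume "i \<in> {0..<j}"
    have "c + of_nat i = of_nat (2 * n + 2 + i)" by (simp add: c_def)
    then show "c \<noteq> - of_nat i" by (metis add_eq_0_iff2 of_nat_eq_0_iff add_is_0 zero_neq_numeral)
  qed
  have "of_int (\<Sum>k\<le>j. of_nat (j choose k) * (-1) ^ k * E_coeff n k)
      = (\<Sum>k\<le>j. (pochhammer (- of_nat j) k / fact k) * (pochhammer c n * (pochhammer a k / pochhammer c k)))"
    using assms unfolding of_int_sum
    by (intro sum.cong refl) (simp add: E pochhammer_uminus_of_nat mult_ac)
  also have "\<dots> = pochhammer c n * (\<Sum>k=0..j. (pochhammer a k * pochhammer (- of_nat j) k) /
      (of_nat (fact k) * pochhammer c k))"
    unfolding sum_distrib_left atMost_atLeast0 by (intro sum.cong refl) (simp add: field_simps)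
  also have "\<dots> = pochhammer c n * (pochhammer (c - a) j / pochhammer c j)"
    using Vandermonde_pochhammer[OF cc, of a] by simp
  also have "c - a = a"
    by (simp add: a_def c_def)
  also have "pochhammer c n * (pochhammer a j / pochhammer c j) = of_int (E_coeff n j)"
    using E[OF assms] by simp
  finally show ?thesis
    by (simp only: of_int_eq_iff)
qed

text \<open>Homogenised with y = a/b, so that replacing y by -y/(1+y) needs no division and makes
  sense in every commutative ring.\<close>

definition G_form :: "nat \<Rightarrow> 'a::comm_ring_1 \<Rightarrow> 'a \<Rightarrow> 'a" where
  "G_form n a b = (\<Sum>k\<le>n. of_nat (n choose k) * of_int (E_coeff n k) * a ^ k * b ^ (n - k))"

lemma sum_triangle_swap: "(\<Sum>k\<le>(n::nat). \<Sum>j\<in>{k..n}. f k j) = (\<Sum>j\<le>n. \<Sum>k\<le>j. f k j)"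
  by (simp add: sum.Sigma, intro sum.reindex_bij_witness[of _ prod.swap prod.swap]) auto

text \<open>After expanding \<open>(a + b) ^ (n - k)\<close> and exchanging the sums, C(n,k)
  C(n-k,j-k) = C(n,j) C(j,k) makes the coefficient of \<open>a ^ j * b ^ (n - j)\<close> a binomial
  transform of \<open>E_coeff\<close>.\<close>

lemma G_form_symmetry: "G_form n (- a) (a + b) = G_form n a b"
proof -
  have inner: "(a + b) ^ (n - k) = (\<Sum>j=k..n. of_nat ((n - k) choose (j - k)) * a ^ (j - k) * b ^ (n - j))"
    if "k \<le> n" for k
    unfolding binomial_ring using that
    by (intro sum.reindex_bij_witness[of _ "\<lambda>j. j - k" "\<lambda>i. i + k"]) (auto simp: add.commute)
  have "G_form n (- a) (a + b) = (\<Sum>k\<le>n. \<Sum>j=k..n. of_nat (n choose j) * (of_nat (j choose k) * (-1) ^ k * of_int (E_coeff n k)) * a ^ j * b ^ (n - j))"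
    unfolding G_form_def
  proof (rule sum.cong[OF refl])
    fix k assume "k \<in> {..n}"
    then have k: "k \<le> n" by simp
    have "of_nat (n choose k) * of_int (E_coeff n k) * (- a) ^ k * (of_nat ((n - k) choose (j - k)) * a ^ (j - k) * b ^ (n - j))
       = of_nat (n choose j) * (of_nat (j choose k) * (-1) ^ k * of_int (E_coeff n k)) * a ^ j * b ^ (n - j)"
      (is "?l = ?r") if j: "j \<in> {k..n}" for j
    proof -
      have "?l = of_nat ((n choose k) * ((n - k) choose (j - k))) * ((- a) ^ k * a ^ (j - k)) * of_int (E_coeff n k) * b ^ (n - j)"
        unfolding of_nat_mult by (simp only: mult_ac)
      also have "(n choose k) * ((n - k) choose (j - k)) = (n choose j) * (j choose k)"
        using choose_mult[of k j n] j by simp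
      also have "(- a) ^ k * a ^ (j - k) = (-1) ^ k * a ^ j"
        using j by (simp add: power_minus[of a] mult.assoc flip: power_add)
      finally show ?thesis
        unfolding of_nat_mult by (simp only: mult_ac)
    qed
    then show "of_nat (n choose k) * of_int (E_coeff n k) * (- a) ^ k * (a + b) ^ (n - k) = (\<Sum>j=k..n. of_nat (n choose j) * (of_nat (j choose k) * (-1) ^ k * of_int (E_coeff n k)) * a ^ j * b ^ (n - j))"
      unfolding inner[OF k] sum_distrib_left by (intro sum.cong refl)
  qed
  also have "\<dots> = (\<Sum>j\<le>n. of_nat (n choose j) * of_int (\<Sum>k\<le>j. of_nat (j choose k) * (-1) ^ k * E_coeff n k) * a ^ j * b ^ (n - j))"
    unfolding sum_triangle_swap
    by (intro sum.cong refl) (simp add: sum_distrib_left sum_distrib_right)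
  also have "\<dots> = G_form n a b"
    unfolding G_form_def by (intro sum.cong refl) (simp add: E_coeff_binomial_transform del: of_int_sum)
  finally show ?thesis .
qed

text \<open>
  Both sides are the coefficient of \<open>u\<^sup>n\<close> in
  \<open>((z - w u)(z u - w))\<^sup>n = ((z + w)\<^sup>2 u - z w (1 + u)\<^sup>2)\<^sup>n\<close>.
\<close>

lemma landen_exact:
  fixes z w :: "'a::comm_ring_1"
  shows "(\<Sum>k\<le>n. of_nat (n choose k) * of_nat ((2 * k) choose k) * (- (z * w)) ^ k * ((z + w)\<^sup>2) ^ (n - k))
       = (\<Sum>k\<le>n. of_nat ((n choose k)\<^sup>2) * (z\<^sup>2) ^ k * (w\<^sup>2) ^ (n - k))"
proof -
  define s where "s = (z + w)\<^sup>2"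
  have fact: "[:z, - w:] * [:- w, z:] = smult (- (z * w)) ([:1, 1:] ^ 2) + monom s 1"
    by (simp add: s_def power2_eq_square monom_altdef algebra_simps)
  have "coeff (([:z, - w:] * [:- w, z:]) ^ n) n
      = (\<Sum>k\<le>n. of_nat (n choose k) * of_nat ((2 * k) choose k) * (- (z * w)) ^ k * s ^ (n - k))"
    unfolding fact binomial_ring coeff_sum
  proof (intro sum.cong refl)
    fix k assume k: "k \<in> {..n}"
    have "of_nat (n choose k) * smult c ([:1, 1:]\<^sup>2) ^ k * monom s 1 ^ (n - k)
       = smult (of_nat (n choose k) * c ^ k) (monom (s ^ (n - k)) (n - k) * [:1, 1:] ^ (2 * k))" for c
      by (simp add: smult_power monom_power of_nat_poly mult.commute flip: smult_smult power_mult)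
    from this[of "- (z * w)"]
    show "coeff (of_nat (n choose k) * smult (- (z * w)) ([:1, 1:]\<^sup>2) ^ k * monom s 1 ^ (n - k)) n
       = of_nat (n choose k) * of_nat ((2 * k) choose k) * (- (z * w)) ^ k * s ^ (n - k)"
      using k by (simp only:) (simp add: coeff_monom_mult coeff_linear_poly_power)
  qed
  moreover have "coeff (([:z, - w:] * [:- w, z:]) ^ n) n
      = (\<Sum>k\<le>n. of_nat ((n choose k)\<^sup>2) * (z\<^sup>2) ^ k * (w\<^sup>2) ^ (n - k))"
    unfolding power_mult_distrib coeff_mult
  \<comment> \<open>The convolution index k carries the power 2k of w, hence the reversal to
    \<open>n - k\<close>.\<close>
  proof (rule sum.reindex_bij_witness[of _ "\<lambda>k. n - k" "\<lambda>k. n - k"], goal_cases)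
    case (5 k)
    then have sym: "n choose (n - k) = n choose k" by (simp add: binomial_symmetric[symmetric])
    have W: "(- w) ^ k * ((- w) ^ k * c) = w ^ k * (w ^ k * c)" for c
      unfolding mult.assoc[symmetric] power_mult_distrib[symmetric] by simp
    show ?case
      using 5 sym by (simp add: coeff_linear_poly_power power2_eq_square power_mult_distrib mult_ac W)
  qed auto
  ultimately show ?thesis unfolding s_def by simp
qed


subsection \<open>Congruences for the coefficients\<close>

lemma Suc_times_binomial_int:
  assumes "k \<le> n"
  shows "(int k + 1) * int (n choose Suc k) = (int n - int k) * int (n choose k)"
proof -
  have "Suc k * (n choose Suc k) = (n - k) * (n choose k)"
    using binomial_absorb_comp[of n k] binomial_absorption[of k n] by simp
  then have "int (Suc k * (n choose Suc k)) = int ((n - k) * (n choose k))" by simp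
  then show ?thesis using assms by (simp add: of_nat_diff algebra_simps)
qed

lemma Suc_times_central_binomial:
  "(int k + 1) * int ((2 * Suc k) choose Suc k) = 2 * (2 * int k + 1) * int ((2 * k) choose k)"
proof -
  have "Suc k * (Suc (2 * k + 1) choose Suc k) = Suc (2 * k + 1) * ((2 * k + 1) choose k)"
    by (rule Suc_times_binomial)
  moreover have "Suc k * (Suc (2 * k) choose Suc k) = Suc (2 * k) * ((2 * k) choose k)"
    by (rule Suc_times_binomial)
  moreover have "Suc (2 * k) choose Suc k = (2 * k + 1) choose k"
    using binomial_symmetric[of k "2 * k + 1"] by simp
  ultimately have "Suc k * (Suc k * ((2 * Suc k) choose Suc k))
      = Suc k * (2 * (2 * k + 1) * ((2 * k) choose k))"
    by (simp add: algebra_simps)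
  then have "Suc k * ((2 * Suc k) choose Suc k) = 2 * (2 * k + 1) * ((2 * k) choose k)"
    by (simp only: mult_cancel1) simp
  then have "int (Suc k * ((2 * Suc k) choose Suc k)) = int (2 * (2 * k + 1) * ((2 * k) choose k))"
    by (rule arg_cong)
  then show ?thesis unfolding of_nat_mult by (simp only: of_nat_Suc of_nat_add of_nat_mult of_nat_numeral of_nat_1 add.commute)
qed

lemma coprime_Suc_less_prime:
  assumes "prime p" "Suc k < p"
  shows "coprime (int k + 1) (int p)"
proof -
  have "coprime (int (Suc k)) (int p)"
    unfolding coprime_int_iff using assms
    by (metis coprime_commute nat_dvd_not_less prime_imp_coprime zero_less_Suc)
  then show ?thesis by (simp add: add.commute)
qed

text \<open>Consecutive terms on the left have ratio (2n+2+k)(2n-k)/(k+1), whose numerator is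
  (p+k+1)(p-k-1) = p^2 - (k+1)^2. The term linear in p cancels, so the congruence holds modulo p^2
  and not only p.\<close>

lemma pochhammer_binomial_cong_sq:
  assumes p: "prime p" "p = 2 * n + 1" and "k \<le> 2 * n"
  shows "[pochhammer (2 * int n + 2) k * int ((2 * n) choose k) = (-1) ^ k * fact k] (mod (int p)\<^sup>2)"
  using \<open>k \<le> 2 * n\<close>
proof (induction k)
  case (Suc k)
  let ?t = "\<lambda>k. pochhammer (2 * int n + 2) k * int ((2 * n) choose k)"
  have "(int k + 1) * ?t (Suc k)
      = (2 * int n + 2 + int k) * pochhammer (2 * int n + 2) k * ((int k + 1) * int ((2 * n) choose Suc k))"
    by (simp add: pochhammer_Suc algebra_simps)
  also have "\<dots> = ((int p)\<^sup>2 - (int k + 1)\<^sup>2) * ?t k"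
    using Suc.prems by (subst Suc_times_binomial_int) (auto simp: p(2) power2_eq_square algebra_simps)
  also have "[\<dots> = (0 - (int k + 1)\<^sup>2) * ((-1) ^ k * fact k)] (mod (int p)\<^sup>2)"
    using Suc by (intro cong_mult[of _ _ _ "?t k"] cong_diff) (auto simp: cong_0_iff)
  also have "(0 - (int k + 1)\<^sup>2) * ((-1) ^ k * fact k) = (int k + 1) * ((-1) ^ Suc k * fact (Suc k))"
    by (simp add: power2_eq_square algebra_simps)
  finally show ?case
    using coprime_Suc_less_prime[OF p(1), of k] Suc.prems p(2)
    by (subst (asm) cong_mult_lcancel) auto
qed simp

text \<open>The same mechanism: the ratio of consecutive terms has numerator 16(n+1+k)(n-k) = 4(p^2
  - (2k+1)^2).\<close>

lemma pochhammer_central_binomial_cong_sq: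
  assumes p: "prime p" "p = 2 * n + 1" and "k \<le> n"
  shows "[16 ^ k * pochhammer (int n + 1) k * int (n choose k)
        = (-1) ^ k * fact k * (int ((2 * k) choose k))\<^sup>2] (mod (int p)\<^sup>2)"
  using \<open>k \<le> n\<close>
proof (induction k)
  case (Suc k)
  let ?t = "\<lambda>k. 16 ^ k * pochhammer (int n + 1) k * int (n choose k)"
  have "(int k + 1) * ?t (Suc k)
      = 16 * 16 ^ k * (int n + 1 + int k) * pochhammer (int n + 1) k * ((int k + 1) * int (n choose Suc k))"
    by (simp add: pochhammer_Suc algebra_simps)
  also have "\<dots> = 4 * ((int p)\<^sup>2 - (2 * int k + 1)\<^sup>2) * ?t k"
    using Suc.prems by (subst Suc_times_binomial_int) (auto simp: p(2) power2_eq_square algebra_simps)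
  also have "[\<dots> = 4 * (0 - (2 * int k + 1)\<^sup>2) * ((-1) ^ k * fact k * (int ((2 * k) choose k))\<^sup>2)] (mod (int p)\<^sup>2)"
    using Suc by (intro cong_mult[of _ _ _ "?t k"] cong_mult[OF cong_refl, of _ _ _ 4] cong_diff) (auto simp: cong_0_iff)
  also have "4 * (0 - (2 * int k + 1)\<^sup>2) * ((-1) ^ k * fact k * (int ((2 * k) choose k))\<^sup>2)
     = (-1) ^ Suc k * fact k * (2 * (2 * int k + 1) * int ((2 * k) choose k))\<^sup>2"
    by (simp add: power2_eq_square algebra_simps)
  also have "\<dots> = (-1) ^ Suc k * fact k * ((int k + 1) * int ((2 * Suc k) choose Suc k))\<^sup>2"
    by (simp only: Suc_times_central_binomial)
  also have "\<dots> = (int k + 1) * ((-1) ^ Suc k * fact (Suc k) * (int ((2 * Suc k) choose Suc k))\<^sup>2)"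
    by (simp only: power_mult_distrib fact_Suc of_nat_Suc power2_eq_square mult_ac add.commute)
  finally show ?case
    using coprime_Suc_less_prime[OF p(1), of k] Suc.prems p(2)
    by (subst (asm) cong_mult_lcancel) auto
qed simp

text \<open>The two preceding congruences share \<open>(-1) ^ k * fact k\<close>; eliminating it
  links the original coefficients to those of G.\<close>

lemma E_coeff_cong_sq:
  assumes p: "prime p" "p = 2 * n + 1" and k: "k \<le> n"
  shows "[pochhammer (2 * int n + 2) n * (int ((2 * n) choose k) * (int ((2 * k) choose k))\<^sup>2)
        = 16 ^ k * (int (n choose k) * E_coeff n k)] (mod (int p)\<^sup>2)"
proof -
  let ?r = "pochhammer (2 * int n + 2 + int k) (n - k)"
  have "pochhammer (2 * int n + 2) n * (int ((2 * n) choose k) * (int ((2 * k) choose k))\<^sup>2)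
      = ?r * ((pochhammer (2 * int n + 2) k * int ((2 * n) choose k)) * (int ((2 * k) choose k))\<^sup>2)"
    using pochhammer_product[OF k, of "2 * int n + 2"] by (simp add: mult_ac)
  also have "[\<dots> = ?r * (((-1) ^ k * fact k) * (int ((2 * k) choose k))\<^sup>2)] (mod (int p)\<^sup>2)"
    using pochhammer_binomial_cong_sq[OF p, of k] k by (intro cong_scalar_left cong_scalar_right) auto
  also have "[?r * (((-1) ^ k * fact k) * (int ((2 * k) choose k))\<^sup>2)
      = ?r * (16 ^ k * pochhammer (int n + 1) k * int (n choose k))] (mod (int p)\<^sup>2)"
    using pochhammer_central_binomial_cong_sq[OF p k] by (intro cong_scalar_left) (rule cong_sym)
  also have "?r * (16 ^ k * pochhammer (int n + 1) k * int (n choose k))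
      = 16 ^ k * (int (n choose k) * E_coeff n k)"
    by (simp add: E_coeff_def mult_ac)
  finally show ?thesis .
qed

lemma cong_pochhammer:
  fixes a b m :: int
  assumes "[a = b] (mod m)"
  shows "[pochhammer a k = pochhammer b k] (mod m)"
  unfolding pochhammer_prod using assms by (intro cong_prod cong_add) auto

text \<open>Modulo p, n + 1 + i is -(n - i) and 2n + 2 is 1, so the two Pochhammer factors become
  (-1)^k k! C(n,k) and n!/k!.\<close>

lemma E_coeff_cong:
  assumes p: "p = 2 * n + 1" and k: "k \<le> n"
  shows "[E_coeff n k = fact n * ((-1) ^ k * int (n choose k))] (mod int p)"
proof -
  have poch: "[pochhammer (int n + 1) k = (-1) ^ k * (fact k * int (n choose k))] (mod int p)"
    using k
  proof (induction k)
    case (Suc k)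
    have "pochhammer (int n + 1) (Suc k) = (int p - (int n - int k)) * pochhammer (int n + 1) k"
      by (simp add: pochhammer_Suc p algebra_simps)
    also have "[\<dots> = (0 - (int n - int k)) * ((-1) ^ k * (fact k * int (n choose k)))] (mod int p)"
      using Suc by (intro cong_mult cong_diff) (auto simp: cong_0_iff)
    also have "(0 - (int n - int k)) * ((-1) ^ k * (fact k * int (n choose k)))
        = (-1) ^ Suc k * fact k * ((int n - int k) * int (n choose k))"
      by (simp add: algebra_simps)
    also have "\<dots> = (-1) ^ Suc k * (fact (Suc k) * int (n choose Suc k))"
      by (subst Suc_times_binomial_int[symmetric])
        (use Suc.prems in \<open>simp_all only: fact_Suc of_nat_Suc mult_ac add.commute Suc_leD\<close>)
    finally show ?case .
  qed simp
  have "[pochhammer (2 * int n + 2 + int k) (n - k) = pochhammer (1 + int k) (n - k)] (mod int p)"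
    by (intro cong_pochhammer) (simp add: p cong_iff_dvd_diff algebra_simps)
  then have "[E_coeff n k = (-1) ^ k * (fact k * int (n choose k)) * pochhammer (1 + int k) (n - k)] (mod int p)"
    unfolding E_coeff_def using poch by (intro cong_mult) auto
  also have "(-1) ^ k * (fact k * int (n choose k)) * pochhammer (1 + int k) (n - k)
      = fact n * ((-1) ^ k * int (n choose k))"
    using pochhammer_product[OF k, of "1 :: int"] by (simp add: mult_ac flip: pochhammer_fact)
  finally show ?thesis .
qed

text \<open>C(2k,k) = (-4)^k C(-1/2,k), and n is -1/2 modulo p.\<close>

lemma central_binomial_cong:
  assumes p: "prime p" "p = 2 * n + 1" and "k \<le> n"
  shows "[int ((2 * k) choose k) = (-4) ^ k * int (n choose k)] (mod int p)"
  using \<open>k \<le> n\<close>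
proof (induction k)
  case (Suc k)
  have "[(int k + 1) * int ((2 * Suc k) choose Suc k) = 2 * (2 * int k + 1) * ((-4) ^ k * int (n choose k))] (mod int p)"
    unfolding Suc_times_central_binomial using Suc by (intro cong_scalar_left) auto
  \<comment> \<open>Subtracting 2p turns 2(2k+1) into -4(n-k).\<close>
  also have "[2 * (2 * int k + 1) * ((-4) ^ k * int (n choose k))
     = (2 * (2 * int k + 1) - 2 * int p) * ((-4) ^ k * int (n choose k))] (mod int p)"
    by (intro cong_mult cong_refl) (simp add: cong_iff_dvd_diff)
  also have "(2 * (2 * int k + 1) - 2 * int p) * ((-4) ^ k * int (n choose k))
     = (-4) ^ Suc k * ((int n - int k) * int (n choose k))"
    by (simp add: p(2) algebra_simps)
  also have "\<dots> = (int k + 1) * ((-4) ^ Suc k * int (n choose Suc k))"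
    using Suc_times_binomial_int[of k n] Suc.prems by (metis Suc_leD mult.left_commute)
  finally show ?case
    using cong_mult_lcancel[OF coprime_Suc_less_prime[OF p(1), of k]] Suc.prems p(2) by force
qed simp

subsection \<open>The Hasse form and congruences in subrings\<close>

definition H_form :: "nat \<Rightarrow> 'a::comm_ring_1 \<Rightarrow> 'a \<Rightarrow> 'a" where
  "H_form n a b = (\<Sum>k\<le>n. of_int ((int (n choose k))\<^sup>2) * a ^ k * b ^ (n - k))"

text \<open>The symmetry \<lambda> to 1/\<lambda>, where \<lambda> = a/b.\<close>

lemma H_form_commute: "H_form n a b = H_form n b a"
  unfolding H_form_def
  by (rule sum.reindex_bij_witness[of _ "\<lambda>k. n - k" "\<lambda>k. n - k"])
    (auto simp: mult_ac simp flip: binomial_symmetric)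

lemma power_sum_scale:
  fixes f :: "nat \<Rightarrow> 'a::comm_ring_1"
  shows "(\<Sum>k\<le>n. f k * (c * a) ^ k * (c * b) ^ (n - k)) = c ^ n * (\<Sum>k\<le>n. f k * a ^ k * b ^ (n - k))"
proof -
  have "f k * (c * a) ^ k * (c * b) ^ (n - k) = c ^ n * (f k * a ^ k * b ^ (n - k))" if "k \<le> n" for k
  proof -
    have "f k * (c * a) ^ k * (c * b) ^ (n - k) = (c ^ k * c ^ (n - k)) * (f k * a ^ k * b ^ (n - k))"
      by (simp only: power_mult_distrib mult_ac)
    then show ?thesis using that by (simp flip: power_add)
  qed
  then show ?thesis by (simp add: sum_distrib_left)
qed

lemma H_form_scale: "H_form n (c * a) (c * b) = c ^ n * H_form n a b"
  unfolding H_form_def by (rule power_sum_scale)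

lemma G_form_scale: "G_form n (c * a) (c * b) = c ^ n * G_form n a b"
  unfolding G_form_def by (rule power_sum_scale)

locale subring_of =
  fixes S :: "'a::comm_ring_1 set"
  assumes one [simp, intro]: "1 \<in> S"
    and diff [simp, intro]: "x \<in> S \<Longrightarrow> y \<in> S \<Longrightarrow> x - y \<in> S"
    and mult [simp, intro]: "x \<in> S \<Longrightarrow> y \<in> S \<Longrightarrow> x * y \<in> S"
begin

lemma zero [simp, intro]: "0 \<in> S"
  using diff[OF one one] by simp

lemma uminus [simp, intro]: "x \<in> S \<Longrightarrow> - x \<in> S"
  using diff[OF zero, of x] by simp

lemma add [simp, intro]: "x \<in> S \<Longrightarrow> y \<in> S \<Longrightarrow> x + y \<in> S"
  using diff[of x "- y"] by simp

lemma of_nat [simp, intro]: "of_nat k \<in> S"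
  by (induction k) auto

lemma of_int [simp, intro]: "of_int k \<in> S"
  by (cases k) (auto simp del: of_nat_Suc)

lemma numeral [simp, intro]: "numeral k \<in> S"
  using of_nat[of "numeral k"] by simp

lemma power [simp, intro]: "x \<in> S \<Longrightarrow> x ^ k \<in> S"
  by (induction k) auto

lemma sum [intro]: "(\<And>k. k \<in> A \<Longrightarrow> f k \<in> S) \<Longrightarrow> sum f A \<in> S"
  by (induction A rule: infinite_finite_induct) auto

text \<open>The quotient must lie in \<open>S\<close>: in an ambient field such as the complex
  numbers every nonzero integer would divide everything.\<close>

definition scong :: "int \<Rightarrow> 'a \<Rightarrow> 'a \<Rightarrow> bool" where
  "scong m x y \<longleftrightarrow> (\<exists>t\<in>S. x - y = of_int m * t)"

lemma scong_refl [simp, intro]: "scong m x x"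
  unfolding scong_def by (intro bexI[of _ 0]) auto

lemma scong_sym: "scong m x y \<Longrightarrow> scong m y x"
  unfolding scong_def by (metis minus_diff_eq mult_minus_right uminus)

lemma scong_add: "scong m x y \<Longrightarrow> scong m x' y' \<Longrightarrow> scong m (x + x') (y + y')"
  unfolding scong_def by (metis add add_diff_add distrib_left)

lemma scong_trans [trans]: "scong m x y \<Longrightarrow> scong m y z \<Longrightarrow> scong m x z"
  unfolding scong_def by (metis add diff_add_cancel diff_diff_eq2 add_diff_eq distrib_left)

lemma scong_lmult: "scong m x y \<Longrightarrow> c \<in> S \<Longrightarrow> scong m (c * x) (c * y)"
  unfolding scong_def by (metis mult mult.left_commute right_diff_distrib)

lemma scong_rmult: "scong m x y \<Longrightarrow> c \<in> S \<Longrightarrow> scong m (x * c) (y * c)"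
  using scong_lmult[of m x y c] by (simp add: mult.commute)

lemma scong_diff: "scong m x y \<Longrightarrow> scong m x' y' \<Longrightarrow> scong m (x - x') (y - y')"
  using scong_add[of m x y "- x'" "- y'"] scong_lmult[of m x' y' "-1"] by simp

text \<open>Source of the square in p^2 for the Pell and \<open>R_seq\<close> sums, which factor
  into two multiples of p.\<close>

lemma scong_zero_mult:
  assumes "scong m x 0" "scong m y 0"
  shows "scong (m\<^sup>2) (x * y) 0"
proof -
  from assms obtain t u where "t \<in> S" "u \<in> S" "x = of_int m * t" "y = of_int m * u"
    unfolding scong_def by auto
  then show ?thesis
    unfolding scong_def by (intro bexI[of _ "t * u"]) (auto simp: power2_eq_square mult_ac)
qed

lemma scong_sum: "(\<And>k. k \<in> A \<Longrightarrow> scong m (f k) (g k)) \<Longrightarrow> scong m (sum f A) (sum g A)"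
  by (induction A rule: infinite_finite_induct) (auto intro: scong_add)

lemma scong_of_int: "[a = b] (mod m) \<Longrightarrow> scong m (of_int a) (of_int b)"
  unfolding scong_def cong_iff_dvd_diff by (metis dvd_def of_int of_int_diff of_int_mult)

text \<open>An inverse of r modulo m is an integer and so lies in \<open>S\<close>.\<close>

lemma scong_cancel:
  assumes "scong m (of_int r * x) (of_int r * y)" "coprime r m" "x \<in> S" "y \<in> S"
  shows "scong m x y"
proof -
  obtain u where u: "[r * u = 1] (mod m)"
    using assms(2) cong_solve_coprime_int by blast
  have red: "scong m (of_int (r * u) * z) z" if "z \<in> S" for z
    using scong_rmult[OF scong_of_int[OF u] that] by simp
  have "scong m x (of_int (r * u) * x)"
    by (rule scong_sym, rule red, fact)
  also have "scong m (of_int (r * u) * x) (of_int (r * u) * y)"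
    using scong_lmult[OF assms(1), of "of_int u"] by (simp add: mult_ac)
  also have "scong m (of_int (r * u) * y) y"
    by (rule red, fact)
  finally show ?thesis .
qed

text \<open>Only the end terms of the binomial expansion survive. This evaluates 2^n, 3^n and the
  unit powers without quadratic reciprocity.\<close>

lemma scong_frobenius:
  assumes "prime p" "x \<in> S" "y \<in> S"
  shows "scong (int p) ((x + y) ^ p) (x ^ p + y ^ p)"
proof -
  have "scong (int p) (\<Sum>k\<le>p. of_nat (p choose k) * x ^ k * y ^ (p - k))
     (\<Sum>k\<le>p. (if k = 0 then y ^ p else 0) + (if k = p then x ^ p else 0))"
  proof (rule scong_sum)
    fix k assume k: "k \<in> {..p}"
    show "scong (int p) (of_nat (p choose k) * x ^ k * y ^ (p - k))
       ((if k = 0 then y ^ p else 0) + (if k = p then x ^ p else 0))"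
    proof (cases "0 < k \<and> k < p")
      case True
      then have "[int (p choose k) = 0] (mod int p)"
        unfolding cong_0_iff using assms dvd_choose_prime[of k p] by auto
      from scong_rmult[OF scong_of_int[OF this], of "x ^ k * y ^ (p - k)"] show ?thesis
        using True assms by (simp add: mult.assoc)
    next
      case False
      with k assms(1) show ?thesis by (auto dest: prime_gt_0_nat)
    qed
  qed
  then show ?thesis
    by (simp add: binomial_ring sum.distrib add.commute)
qed

lemma H_form_in [intro]: "a \<in> S \<Longrightarrow> b \<in> S \<Longrightarrow> H_form n a b \<in> S"
  unfolding H_form_def by (intro sum mult power of_int)

text \<open>Termwise from \<open>E_coeff_cong\<close>; the sign \<open>(-1) ^ k\<close> moves into
  \<open>- a\<close>.\<close>

lemma G_form_scong:
  assumes "p = 2 * n + 1" "a \<in> S" "b \<in> S"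
  shows "scong (int p) (G_form n a b) (of_int (fact n) * H_form n (- a) b)"
  unfolding G_form_def H_form_def sum_distrib_left
proof (rule scong_sum)
  fix k assume k: "k \<in> {..n}"
  have "[int (n choose k) * E_coeff n k = int (n choose k) * (fact n * ((-1) ^ k * int (n choose k)))] (mod int p)"
    using k by (intro cong_scalar_left E_coeff_cong assms) auto
  from scong_rmult[OF scong_of_int[OF this], of "a ^ k * b ^ (n - k)"]
  have "scong (int p) (of_nat (n choose k) * of_int (E_coeff n k) * a ^ k * b ^ (n - k))
      (of_nat (n choose k) * (of_int (fact n) * ((-1) ^ k * of_nat (n choose k))) * (a ^ k * b ^ (n - k)))"
    using assms by (simp add: mult.assoc)
  also have "of_nat (n choose k) * (of_int (fact n) * ((-1) ^ k * of_nat (n choose k))) * (a ^ k * b ^ (n - k))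
      = of_int (fact n) * (of_int ((int (n choose k))\<^sup>2) * (- a) ^ k * b ^ (n - k))"
    by (simp add: power2_eq_square power_minus[of a] mult_ac)
  finally show "scong (int p) (of_nat (n choose k) * of_int (E_coeff n k) * a ^ k * b ^ (n - k))
      (of_int (fact n) * (of_int ((int (n choose k))\<^sup>2) * (- a) ^ k * b ^ (n - k)))" .
qed

text \<open>The symmetry \<lambda> to \<lambda>/(\<lambda>-1), inherited from
  \<open>G_form_symmetry\<close>; the factor \<open>fact n\<close> is cancelled because n <
  p.\<close>

lemma H_form_scong:
  assumes p: "prime p" "p = 2 * n + 1" and ab: "a \<in> S" "b \<in> S"
  shows "scong (int p) (H_form n a b) (H_form n (- a) (b - a))"
proof (rule scong_cancel)
  have "scong (int p) (of_int (fact n) * H_form n a b) (G_form n (- a) b)"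
    using G_form_scong[OF p(2), of "- a" b] ab by (auto intro: scong_sym)
  also have "G_form n (- a) b = G_form n a (b - a)"
    using G_form_symmetry[of n "- a" b] by simp
  also have "scong (int p) \<dots> (of_int (fact n) * H_form n (- a) (b - a))"
    using G_form_scong[OF p(2), of a "b - a"] ab by auto
  finally show "scong (int p) (of_int (fact n) * H_form n a b) (of_int (fact n) * H_form n (- a) (b - a))" .
  have "coprime (fact n) p"
    using p by (metis coprime_commute prime_dvd_fact_iff prime_imp_coprime not_less_eq_eq le_add1 mult_2 add.commute plus_1_eq_Suc)
  then have "coprime (int (fact n)) (int p)" by (simp only: coprime_int_iff)
  then show "coprime (fact n) (int p)" by simp
qed (use ab in auto)

text \<open>Landen's transformation between \<lambda> = 4zw/(z+w)^2 and (z/w)^2: in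
  \<open>landen_exact\<close>, C(2k,k) is replaced by (-4)^k C(n,k).\<close>

lemma landen_scong:
  assumes p: "prime p" "p = 2 * n + 1" and zw: "z \<in> S" "w \<in> S"
  shows "scong (int p) (H_form n (4 * (z * w)) ((z + w)\<^sup>2)) (H_form n (z\<^sup>2) (w\<^sup>2))"
proof -
  have "H_form n (z\<^sup>2) (w\<^sup>2)
      = (\<Sum>k\<le>n. of_nat (n choose k) * of_nat ((2 * k) choose k) * (- (z * w)) ^ k * ((z + w)\<^sup>2) ^ (n - k))"
    unfolding H_form_def landen_exact by simp
  moreover have "scong (int p) \<dots> (H_form n (4 * (z * w)) ((z + w)\<^sup>2))"
    unfolding H_form_def
  proof (rule scong_sum)
    fix k assume k: "k \<in> {..n}"
    have "[int (n choose k) * int ((2 * k) choose k) = int (n choose k) * ((-4) ^ k * int (n choose k))] (mod int p)"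
      using k by (intro cong_scalar_left central_binomial_cong p) auto
    from scong_rmult[OF scong_of_int[OF this], of "(- (z * w)) ^ k * ((z + w)\<^sup>2) ^ (n - k)"]
    have "scong (int p) (of_nat (n choose k) * of_nat ((2 * k) choose k) * (- (z * w)) ^ k * ((z + w)\<^sup>2) ^ (n - k))
      (of_nat (n choose k) * ((-4) ^ k * of_nat (n choose k)) * ((- (z * w)) ^ k * ((z + w)\<^sup>2) ^ (n - k)))"
      using zw by (simp add: mult.assoc)
    also have "of_nat (n choose k) * ((-4) ^ k * of_nat (n choose k)) * ((- (z * w)) ^ k * ((z + w)\<^sup>2) ^ (n - k))
       = (of_nat (n choose k))\<^sup>2 * ((-4) ^ k * (- (z * w)) ^ k) * ((z + w)\<^sup>2) ^ (n - k)"
      by (simp only: power2_eq_square mult_ac)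
    also have "(-4) ^ k * (- (z * w)) ^ k = (4 * (z * w)) ^ k"
      unfolding power_mult_distrib[symmetric] by simp
    finally show "scong (int p) (of_nat (n choose k) * of_nat ((2 * k) choose k) * (- (z * w)) ^ k * ((z + w)\<^sup>2) ^ (n - k))
      (of_int ((int (n choose k))\<^sup>2) * (4 * (z * w)) ^ k * ((z + w)\<^sup>2) ^ (n - k))"
      by simp
  qed
  ultimately show ?thesis by (simp add: scong_sym)
qed

end

section \<open>The ring Z[sqrt d, i] and descent from it to the integers\<close>

definition sqrt_i_ring :: "nat \<Rightarrow> complex set" where
  "sqrt_i_ring d = {Complex (of_int a + of_int b * sqrt d) (of_int c + of_int e * sqrt d) | a b c e. True}"

lemma sqrt_i_ringI:
  "z = of_int a + of_int b * of_real (sqrt d) + of_int c * \<i> + of_int e * of_real (sqrt d) * \<i>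
    \<Longrightarrow> z \<in> sqrt_i_ring d"
  unfolding sqrt_i_ring_def by (auto simp: complex_eq_iff)

interpretation sqrt_i: subring_of "sqrt_i_ring d" for d
proof
  show "1 \<in> sqrt_i_ring d"
    by (rule sqrt_i_ringI[of _ 1 0 d 0 0]) simp
next
  fix x y assume "x \<in> sqrt_i_ring d" "y \<in> sqrt_i_ring d"
  then obtain a b c e a' b' c' e' :: int where
    x: "x = Complex (of_int a + of_int b * sqrt d) (of_int c + of_int e * sqrt d)" and
    y: "y = Complex (of_int a' + of_int b' * sqrt d) (of_int c' + of_int e' * sqrt d)"
    unfolding sqrt_i_ring_def by auto
  show "x - y \<in> sqrt_i_ring d"
    by (rule sqrt_i_ringI[of _ "a - a'" "b - b'" d "c - c'" "e - e'"])
      (simp add: complex_eq_iff x y algebra_simps)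
  have s: "sqrt d * (sqrt d * r) = real d * r" "sqrt d * sqrt d = real d" for r
    by (simp_all flip: mult.assoc)
  show "x * y \<in> sqrt_i_ring d"
    by (rule sqrt_i_ringI[of _ "a * a' + int d * (b * b') - c * c' - int d * (e * e')"
          "a * b' + b * a' - c * e' - e * c'" d
          "a * c' + int d * (b * e') + c * a' + int d * (e * b')"
          "a * e' + b * c' + c * b' + e * a'"])
      (simp add: complex_eq_iff x y algebra_simps s)
qed

lemma sqrt_in_sqrt_i_ring [simp, intro]: "of_real (sqrt d) \<in> sqrt_i_ring d"
  by (rule sqrt_i_ringI[of _ 0 1 d 0 0]) simp

lemma i_in_sqrt_i_ring [simp, intro]: "\<i> \<in> sqrt_i_ring d"
  by (rule sqrt_i_ringI[of _ 0 0 d 1 0]) simp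

text \<open>Irrationality of sqrt q: for nonzero y the multiplicity of q would be even on the left
  and odd on the right.\<close>

lemma square_eq_prime_times_square:
  fixes x y q :: int
  assumes "prime q" "x\<^sup>2 = q * y\<^sup>2"
  shows "y = 0"
proof (rule ccontr)
  assume y: "y \<noteq> 0"
  with assms have x: "x \<noteq> 0" by auto
  have q: "prime_elem q" using assms(1) by (rule prime_imp_prime_elem)
  have "2 * multiplicity q x = multiplicity q (x\<^sup>2)"
    using prime_elem_multiplicity_power_distrib[OF q x] by simp
  also have "\<dots> = multiplicity q q + 2 * multiplicity q y"
    unfolding assms(2) using y q prime_elem_multiplicity_power_distrib[OF q y]
    by (subst prime_elem_multiplicity_mult_distrib) auto
  also have "multiplicity q q = 1"
    using q by (intro multiplicity_self) (auto simp: prime_elem_def)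
  finally show False by presburger
qed

text \<open>Real parts give N = m(a + b sqrt d), and irrationality of sqrt d forces mb = 0.\<close>

lemma sqrt_i_scong_imp_dvd:
  assumes "sqrt_i.scong d m (of_int N) 0" "prime d"
  shows "m dvd N"
proof -
  obtain t where t: "t \<in> sqrt_i_ring d" "of_int N = of_int m * t"
    using assms(1) unfolding sqrt_i.scong_def by auto
  then obtain a b c e :: int where
    "of_int N = of_int m * Complex (of_int a + of_int b * sqrt d) (of_int c + of_int e * sqrt d)"
    unfolding sqrt_i_ring_def by auto
  then have *: "real_of_int N = of_int m * (of_int a + of_int b * sqrt d)"
    by (simp add: complex_eq_iff)
  then have "real_of_int (N - m * a) = of_int (m * b) * sqrt d"
    by (simp add: algebra_simps)
  then have "(real_of_int (N - m * a))\<^sup>2 = (of_int (m * b))\<^sup>2 * d"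
    by (simp only: power_mult_distrib) simp
  then have "real_of_int ((N - m * a)\<^sup>2) = of_int (int d * (m * b)\<^sup>2)"
    by (simp add: mult.commute)
  then have "(N - m * a)\<^sup>2 = int d * (m * b)\<^sup>2"
    by (simp only: of_int_eq_iff)
  then have "m * b = 0"
    using assms(2) by (intro square_eq_prime_times_square) auto
  with * have "real_of_int N = of_int (m * a)" by auto
  then have "N = m * a" by (simp only: of_int_eq_iff)
  then show ?thesis by simp
qed

text \<open>Euler's criterion for 2 when p is 7 modulo 8: the exact p-th power of
  \<open>1 + \<i>\<close>, computed from (1+i)^2 = 2i, is compared with Frobenius.\<close>

lemma two_power_half_scong:
  assumes p: "prime p" "p = 2 * n + 1" and n: "n mod 4 = 3"
  shows "sqrt_i.scong d (int p) (2 ^ n) 1"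
proof (rule sqrt_i.scong_cancel)
  have i: "\<i> ^ n = - \<i>"
  proof -
    obtain m where "n = 4 * m + 3" using n by (metis mult_div_mod_eq)
    moreover have "\<i> ^ 4 = 1" "\<i> ^ 3 = - \<i>" by (simp_all add: eval_nat_numeral)
    ultimately show ?thesis by (simp only: power_add power_mult power_one mult_1)
  qed
  have odd: "odd n" using n by presburger
  have sq: "(1 + \<i>)\<^sup>2 = 2 * \<i>" by (simp add: power2_eq_square algebra_simps)
  have l: "(1 + \<i>) ^ p = 2 ^ n * (1 - \<i>)"
    unfolding p(2) power_add power_mult sq power_mult_distrib i by (simp add: algebra_simps)
  have r: "1 ^ p + \<i> ^ p = 1 - \<i>"
    unfolding p(2) power_add power_mult using odd by simp
  have "sqrt_i.scong d (int p) (2 ^ n * (1 - \<i>)) (1 - \<i>)"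
    using sqrt_i.scong_frobenius[OF p(1), of 1 d \<i>] unfolding l r by simp
  \<comment> \<open>(1-i)(1+i) = 2 replaces the factor 1-i by an integer prime to p.\<close>
  from sqrt_i.scong_rmult[OF this, of "1 + \<i>"]
  show "sqrt_i.scong d (int p) (of_int 2 * 2 ^ n) (of_int 2 * 1)"
    by (simp add: algebra_simps)
  show "coprime 2 (int p)" using p(2) by simp
qed auto

lemma scong_two_power_prime:
  assumes "prime p"
  shows "sqrt_i.scong d (int p) (2 ^ p) 2"
  using sqrt_i.scong_frobenius[OF assms, of 1 d 1] by simp

subsection \<open>Pell numbers\<close>

context
  fixes p n :: nat and s :: complex
  assumes p: "prime p" "p = 2 * n + 1" "p mod 8 = 7"
    and s: "s = of_real (sqrt (real 2))"
begin

lemma sqrt2_mult: "s * s = 2" "s * (s * x) = 2 * x"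
  unfolding s by (simp_all flip: of_real_mult mult.assoc)

lemma sqrt2_in_ring [simp]: "s \<in> sqrt_i_ring 2"
  unfolding s using sqrt_in_sqrt_i_ring[of 2] by simp

lemma half_mod_4: "n mod 4 = 3"
  using p by presburger

text \<open>As 2^n is 1 modulo p, Frobenius fixes \<open>1 + s\<close>; one factor is then removed
  with the inverse \<open>s - 1\<close>.\<close>

lemma unit_power_sqrt2: "sqrt_i.scong 2 (int p) ((1 + s) ^ (2 * n)) 1"
proof -
  have "s ^ p = 2 ^ n * s"
    unfolding p(2) by (simp add: power_mult power2_eq_square sqrt2_mult)
  then have "sqrt_i.scong 2 (int p) ((1 + s) ^ p) (1 + 2 ^ n * s)"
    using sqrt_i.scong_frobenius[OF p(1), of 1 2 s] by simp
  also have "sqrt_i.scong 2 (int p) (1 + 2 ^ n * s) (1 + 1 * s)"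
    by (intro sqrt_i.scong_add sqrt_i.scong_rmult two_power_half_scong[OF p(1,2) half_mod_4]) auto
  finally have "sqrt_i.scong 2 (int p) ((1 + s) ^ p * (s - 1)) ((1 + 1 * s) * (s - 1))"
    by (rule sqrt_i.scong_rmult) auto
  moreover have "(1 + s) * (s - 1) = 1" by (simp add: algebra_simps sqrt2_mult)
  then have "(1 + 1 * s) * (s - 1) = 1" "(1 + s) ^ p * (s - 1) = (1 + s) ^ (2 * n)"
    unfolding p(2) by (simp_all add: mult.assoc mult.left_commute)
  ultimately show ?thesis by simp
qed

text \<open>With z = s - 1, Landen's transformation leads from 2z to z^2. Since z^2 - 1 = -2z, the
  other two symmetries lead back to 2z with the sign (-1)^n = -1, so the value is its own
  negative.\<close>

lemma H_form_sqrt2: "sqrt_i.scong 2 (int p) (H_form n (2 * (s - 1)) 1) 0"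
proof (rule sqrt_i.scong_cancel)
  define z where "z = s - 1"
  have z: "z \<in> sqrt_i_ring 2" "z\<^sup>2 - 1 = - (2 * z)" "(z + 1)\<^sup>2 = 2"
    unfolding z_def by (auto simp: power2_eq_square algebra_simps sqrt2_mult)
  have odd: "odd n" using half_mod_4 by presburger
  let ?h = "H_form n (2 * z) 1"
  have h: "?h \<in> sqrt_i_ring 2" using z by auto
  have "sqrt_i.scong 2 (int p) (1 * ?h) (2 ^ n * ?h)"
    \<comment> \<open>The factor 2^n, which is 1 modulo p, rescales the pair (2z, 1) to (4z, 2), the
      shape required by Landen with (z+1)^2 = 2.\<close>
    by (intro sqrt_i.scong_rmult sqrt_i.scong_sym[OF two_power_half_scong[OF p(1,2) half_mod_4]] h)
  also have "2 ^ n * ?h = H_form n (4 * (z * 1)) ((z + 1)\<^sup>2)"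
    using H_form_scale[of n 2 "2 * z" 1] z(3) by simp
  also have "sqrt_i.scong 2 (int p) \<dots> (H_form n (z\<^sup>2) (1\<^sup>2))"
    using z by (intro sqrt_i.landen_scong p) auto
  also have "H_form n (z\<^sup>2) (1\<^sup>2) = H_form n 1 (z\<^sup>2)"
    by (simp add: H_form_commute)
  also have "sqrt_i.scong 2 (int p) \<dots> (H_form n (- 1) (z\<^sup>2 - 1))"
    using z by (intro sqrt_i.H_form_scong p) auto
  also have "\<dots> = - ?h"
    using H_form_scale[of n "- 1" 1 "2 * z"] odd z(2) H_form_commute[of n 1 "2 * z"] by simp
  finally have "sqrt_i.scong 2 (int p) (1 * ?h + ?h) (- ?h + ?h)"
    by (intro sqrt_i.scong_add) auto
  then show "sqrt_i.scong 2 (int p) (of_int 2 * H_form n (2 * (s - 1)) 1) (of_int 2 * 0)"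
    by (simp add: z_def)
  show "coprime 2 (int p)" using p(2) by simp
  show "H_form n (2 * (s - 1)) 1 \<in> sqrt_i_ring 2" using h by (simp add: z_def)
qed auto

lemma pell_closed: "2 * s * of_int (pell k) = (1 + s) ^ k - (1 - s) ^ k"
proof (induction k rule: pell.induct)
  case (3 k)
  have "(1 + s) ^ Suc (Suc k) - (1 - s) ^ Suc (Suc k)
     = 2 * ((1 + s) ^ Suc k - (1 - s) ^ Suc k) + ((1 + s) ^ k - (1 - s) ^ k)"
    unfolding power_Suc
    by (simp add: algebra_simps sqrt2_mult)
  then show ?case unfolding 3[symmetric] by (simp add: algebra_simps)
qed (simp_all add: sqrt2_mult)

lemma pell_sum_dvd:
  "(int p)\<^sup>2 dvd (\<Sum>k\<le>n. int (n choose k) * E_coeff n k * (2 ^ k * pell k))"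
    (is "_ dvd ?N")
proof -
  define a b where "a = 1 + s" and "b = 1 - s"
  have ab: "a \<in> sqrt_i_ring 2" "b \<in> sqrt_i_ring 2" unfolding a_def b_def by auto
  have "G_form n (2 * a) 1 = G_form n (a\<^sup>2 * (2 * b)) (a\<^sup>2 * 1)"
  proof -
    \<comment> \<open>From a^2 = 2a + 1 and ab = -1: for y = 2a, 1 + y = a^2 and -y/(1+y) =
      2b.\<close>
    have "- (2 * a) = a\<^sup>2 * (2 * b)" "2 * a + 1 = a\<^sup>2 * 1"
      unfolding a_def b_def power2_eq_square by (simp_all add: algebra_simps sqrt2_mult)
    from this[symmetric] show ?thesis by (simp only: G_form_symmetry)
  qed
  also have "\<dots> = a ^ (2 * n) * G_form n (2 * b) 1"
    unfolding G_form_scale by (simp add: power_mult)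
  finally have G: "G_form n (2 * a) 1 - G_form n (2 * b) 1 = (a ^ (2 * n) - 1) * G_form n (2 * b) 1"
    by (simp add: algebra_simps)
  have "2 * s * of_int ?N = G_form n (2 * a) 1 - G_form n (2 * b) 1"
    unfolding G_form_def of_int_sum sum_distrib_left sum_subtractf[symmetric]
  proof (intro sum.cong refl)
    fix k
    have "2 * s * of_int (int (n choose k) * E_coeff n k * (2 ^ k * pell k))
       = of_nat (n choose k) * of_int (E_coeff n k) * 2 ^ k * (2 * s * of_int (pell k))"
      by simp
    also have "\<dots> = of_nat (n choose k) * of_int (E_coeff n k) * 2 ^ k * (a ^ k - b ^ k)"
      unfolding pell_closed a_def b_def ..
    finally show "2 * s * of_int (int (n choose k) * E_coeff n k * (2 ^ k * pell k))
       = of_nat (n choose k) * of_int (E_coeff n k) * (2 * a) ^ k * 1 ^ (n - k)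
       - of_nat (n choose k) * of_int (E_coeff n k) * (2 * b) ^ k * 1 ^ (n - k)"
      by (simp add: power_mult_distrib algebra_simps)
  qed
  also note G
  also have "sqrt_i.scong 2 ((int p)\<^sup>2) ((a ^ (2 * n) - 1) * G_form n (2 * b) 1) 0"
  proof (rule sqrt_i.scong_zero_mult)
    show "sqrt_i.scong 2 (int p) (a ^ (2 * n) - 1) 0"
      using sqrt_i.scong_diff[OF unit_power_sqrt2 sqrt_i.scong_refl[of 2 "int p" 1]] by (simp add: a_def)
    have "sqrt_i.scong 2 (int p) (G_form n (2 * b) 1) (of_int (fact n) * H_form n (- (2 * b)) 1)"
      using ab by (intro sqrt_i.G_form_scong p) auto
    also have "- (2 * b) = 2 * (s - 1)" by (simp add: b_def)
    also have "sqrt_i.scong 2 (int p) (of_int (fact n) * H_form n (2 * (s - 1)) 1) (of_int (fact n) * 0)"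
      by (intro sqrt_i.scong_lmult H_form_sqrt2) (rule sqrt_i.of_int)
    finally show "sqrt_i.scong 2 (int p) (G_form n (2 * b) 1) 0" by simp
  qed
  \<comment> \<open>A further factor s makes the multiplier rational: 2 s^2 = 4.\<close>
  finally have "sqrt_i.scong 2 ((int p)\<^sup>2) (s * (2 * s * of_int ?N)) (s * 0)"
    by (rule sqrt_i.scong_lmult) auto
  also have "s * (2 * s * of_int ?N) = of_int (4 * ?N)"
    by (simp add: mult.assoc mult.left_commute sqrt2_mult)
  finally have "(int p)\<^sup>2 dvd 4 * ?N"
    using sqrt_i_scong_imp_dvd[of 2 _ "4 * ?N"] by simp
  moreover have "coprime ((int p)\<^sup>2) 4"
    using p(2) coprime_power_right_iff[of "(int p)\<^sup>2" 2 2] by simp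
  ultimately show ?thesis by (simp only: coprime_dvd_mult_right_iff)
qed

end

subsection \<open>The sequence with characteristic roots \<open>2 \<plusminus> \<surd>3\<close>\<close>

context
  fixes p n :: nat and s :: complex
  assumes p: "prime p" "p = 2 * n + 1" "p mod 12 = 11"
    and s: "s = of_real (sqrt (real 3))"
begin

lemma sqrt3_mult: "s * s = 3" "s * (s * x) = 3 * x"
  unfolding s by (simp_all flip: of_real_mult mult.assoc)

lemma sqrt3_in_ring [simp]: "s \<in> sqrt_i_ring 3"
  unfolding s using sqrt_in_sqrt_i_ring[of 3] by simp

lemma half_mod_6: "n mod 6 = 5"
  using p by presburger

lemma coprime_2_3: "coprime 2 (int p)" "coprime 3 (int p)"
proof -
  show "coprime 2 (int p)" using p(2) by simp
  have "\<not> 3 dvd p" using p(3) by presburger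
  then have "coprime 3 p" by (simp add: prime_imp_coprime)
  then have "coprime (int 3) (int p)" by (simp only: coprime_int_iff)
  then show "coprime 3 (int p)" by simp
qed

text \<open>Euler's criterion for 3: with t = sqrt(-3), \<open>1 + t\<close> is twice a primitive
  sixth root of unity, so its p-th power is known exactly and can be compared with
  Frobenius.\<close>

lemma three_power_half_scong: "sqrt_i.scong 3 (int p) (3 ^ n) 1"
proof (rule sqrt_i.scong_cancel)
  define t where "t = \<i> * s"
  have t: "t \<in> sqrt_i_ring 3" "t * t = - 3" "t * (t * x) = - 3 * x" for x
    unfolding t_def by (auto simp: mult_ac sqrt3_mult)
  have odd: "odd n" using half_mod_6 by presburger
  define m where "m = n div 3"
  have pm: "p = 6 * m + 5" using half_mod_6 p(2) unfolding m_def by presburger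
  have u6: "(1 + t) ^ 6 = 64" and u5: "(1 + t) ^ 5 = 16 * (1 - t)"
    by (simp_all add: eval_nat_numeral algebra_simps t)
  have "(1 + t) ^ p = 64 ^ m * (16 * (1 - t))"
    unfolding pm power_add power_mult u6 u5 ..
  moreover have "2 ^ p = (64 :: complex) ^ m * 32"
    unfolding pm power_add power_mult by simp
  ultimately have u: "2 * (1 + t) ^ p = 2 ^ p * (1 - t)" by simp
  have tp: "t ^ p = - t * 3 ^ n"
    unfolding p(2) using odd by (simp add: power_mult power2_eq_square t power_minus[of 3])
  have "sqrt_i.scong 3 (int p) (2 ^ p * (1 - t)) (2 * (1 - t * 3 ^ n))"
    using sqrt_i.scong_lmult[OF sqrt_i.scong_frobenius[OF p(1), of 1 3 t], of 2] t tp u by simp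
  then have "sqrt_i.scong 3 (int p) (2 * (1 - t * 3 ^ n)) (2 * (1 - t))"
    using sqrt_i.scong_rmult[OF scong_two_power_prime[OF p(1)], of "1 - t" 3] t(1)
    by (meson sqrt_i.diff sqrt_i.one sqrt_i.scong_sym sqrt_i.scong_trans)
  \<comment> \<open>Subtracting 2 leaves -2t 3^n and -2t; multiplication by t turns these into 6 *
    3^n and 6.\<close>
  from sqrt_i.scong_rmult[OF sqrt_i.scong_diff[OF this sqrt_i.scong_refl[of 3 _ 2]], of t]
  show "sqrt_i.scong 3 (int p) (of_int 6 * 3 ^ n) (of_int 6 * 1)"
    using t by (simp add: algebra_simps)
  show "coprime 6 (int p)"
    using coprime_2_3 coprime_mult_left_iff[of 2 3 "int p"] by simp
qed auto

text \<open>Frobenius fixes \<open>2 + s\<close> because 3^n is 1 modulo p; the inverse is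
  \<open>2 - s\<close>.\<close>

lemma unit_power_sqrt3: "sqrt_i.scong 3 (int p) ((2 + s) ^ (2 * n)) 1"
proof -
  have "s ^ p = 3 ^ n * s"
    unfolding p(2) by (simp add: power_mult power2_eq_square sqrt3_mult)
  then have "sqrt_i.scong 3 (int p) ((2 + s) ^ p) (2 ^ p + 3 ^ n * s)"
    using sqrt_i.scong_frobenius[OF p(1), of 2 3 s] by simp
  also have "sqrt_i.scong 3 (int p) (2 ^ p + 3 ^ n * s) (2 + 1 * s)"
    by (intro sqrt_i.scong_add sqrt_i.scong_rmult three_power_half_scong scong_two_power_prime p sqrt3_in_ring)
  finally have "sqrt_i.scong 3 (int p) ((2 + s) ^ p * (2 - s)) ((2 + 1 * s) * (2 - s))"
    by (rule sqrt_i.scong_rmult) auto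
  moreover have "(2 + s) * (2 - s) = 1" by (simp add: algebra_simps sqrt3_mult)
  then have "(2 + 1 * s) * (2 - s) = 1" "(2 + s) ^ p * (2 - s) = (2 + s) ^ (2 * n)"
    unfolding p(2) by (simp_all add: mult.assoc mult.left_commute)
  ultimately show ?thesis by simp
qed

text \<open>
  Here \<open>\<eta> = (1 + \<i>\<surd>3)/2\<close> is a primitive sixth root of unity, so that
  \<open>\<eta>/(\<eta>-1) = 1/\<eta>\<close>; the two symmetries together multiply the value at \<open>\<eta>\<close>
  by \<open>(-\<eta>)\<^sup>n \<noteq> 1\<close>.
\<close>

lemma H_form_sixth_root: "sqrt_i.scong 3 (int p) (H_form n (1 + \<i> * s) 2) 0"
proof (rule sqrt_i.scong_cancel)
  define u where "u = 1 + \<i> * s"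
  have u: "u \<in> sqrt_i_ring 3" "u * u = 2 * u - 4" "u * (u * x) = (2 * u - 4) * x" for x
    unfolding u_def by (auto simp: algebra_simps sqrt3_mult)
  let ?h = "H_form n u 2"
  define m where "m = n div 6"
  have nm: "n = 6 * m + 5" using half_mod_6 unfolding m_def by presburger
  have "(- u) ^ 6 = 64" and "(- u) ^ 5 = 8 * (2 * u - 4)"
    by (simp_all add: eval_nat_numeral algebra_simps u)
  then have un: "(- u) ^ n = 64 ^ m * (8 * (2 * u - 4))"
    unfolding nm power_add power_mult by simp
  have two: "2 ^ n = (64 :: complex) ^ m * 32"
    unfolding nm power_add power_mult by simp
  \<comment> \<open>As u^2 = 2u - 4, doubling 2 - u gives (-u)u: a common factor -u appears and the
    swapped pair (2, u) remains.\<close>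
  have "H_form n (- u) (2 - u) * 2 ^ n = H_form n ((- u) * 2) ((- u) * u)"
    using H_form_scale[of n 2 "- u" "2 - u"] by (simp add: algebra_simps u)
  also have "\<dots> = (- u) ^ n * ?h"
    unfolding H_form_scale by (simp add: H_form_commute)
  finally have "sqrt_i.scong 3 (int p) (?h * 2 ^ n) ((- u) ^ n * ?h)"
    using sqrt_i.scong_rmult[OF sqrt_i.H_form_scong[OF p(1,2) u(1), of 2], of "2 ^ n"] by simp
  \<comment> \<open>2^n - (-u)^n = 64^m * 16(4 - u). The multiplier 4 + 2u is twice the conjugate of
    4 - u, and (4 - u)(4 + 2u) = 24 leaves the integer 64^m * 384.\<close>
  from sqrt_i.scong_diff[OF this sqrt_i.scong_refl[of 3 _ "(- u) ^ n * ?h"]]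
  have "sqrt_i.scong 3 (int p) ((4 + 2 * u) * (?h * 2 ^ n - (- u) ^ n * ?h)) ((4 + 2 * u) * 0)"
    using u(1) by (intro sqrt_i.scong_lmult) auto
  also have "(4 + 2 * u) * (?h * 2 ^ n - (- u) ^ n * ?h) = of_int (64 ^ m * 384) * ?h"
    unfolding un two by (simp add: algebra_simps u)
  finally show "sqrt_i.scong 3 (int p) (of_int (64 ^ m * 384) * H_form n (1 + \<i> * s) 2)
      (of_int (64 ^ m * 384) * 0)"
    by (simp add: u_def)
  have pow: "coprime (2 ^ 6) (int p)" "coprime (2 ^ 7) (int p)"
    by (intro coprime_power_left_iff[THEN iffD2] disjI1 coprime_2_3)+
  have "coprime (2 ^ 6) (int p)" "coprime (2 ^ 7 * 3) (int p)"
    by (intro coprime_mult_left_iff[THEN iffD2] conjI pow coprime_2_3)+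
  then show "coprime (64 ^ m * 384) (int p)" by simp
  show "H_form n (1 + \<i> * s) 2 \<in> sqrt_i_ring 3" using u(1) by (auto simp: u_def)
qed auto

text \<open>
  Landen's transformation links \<open>4(2 - \<surd>3)\<close> to the square of
  \<open>(\<surd>3 + \<i>)/2\<close>, which is a primitive sixth root of unity.
\<close>

lemma H_form_sqrt3: "sqrt_i.scong 3 (int p) (H_form n (4 * (2 - s)) 1) 0"
proof (rule sqrt_i.scong_cancel)
  \<comment> \<open>\<open>z\<close> is twice a primitive twelfth root of unity, \<open>z'\<close>
    its conjugate; Landen is applied with w = 2.\<close>
  define z z' where "z = s + \<i>" and "z' = s - \<i>"
  have z: "z \<in> sqrt_i_ring 3" "z' \<in> sqrt_i_ring 3"
    "z\<^sup>2 = 2 * (1 + \<i> * s)" "z * z' = 4" "(z + 2)\<^sup>2 = (2 * (2 + s) * z) * 1"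
    "4 * (z * 2) = (2 * (2 + s) * z) * (4 * (2 - s))"
    unfolding z_def z'_def power2_eq_square by (auto simp: algebra_simps sqrt3_mult)
  have "(2 * (2 + s) * z) ^ n * H_form n (4 * (2 - s)) 1 = H_form n (4 * (z * 2)) ((z + 2)\<^sup>2)"
    unfolding z(5,6) H_form_scale ..
  also have "sqrt_i.scong 3 (int p) \<dots> (H_form n (z\<^sup>2) (2\<^sup>2))"
    using z by (intro sqrt_i.landen_scong p) auto
  also have "H_form n (z\<^sup>2) (2\<^sup>2) = 2 ^ n * H_form n (1 + \<i> * s) 2"
    unfolding z(3) using H_form_scale[of n 2 "1 + \<i> * s" 2] by simp
  also have "sqrt_i.scong 3 (int p) \<dots> (2 ^ n * 0)"
    by (intro sqrt_i.scong_lmult H_form_sixth_root) auto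
  \<comment> \<open>The multiplier inverts \<open>2 * (2 + s) * z\<close> up to the integer 8, whose
    n-th power can be cancelled.\<close>
  finally have "sqrt_i.scong 3 (int p) (((2 - s) * z') ^ n * ((2 * (2 + s) * z) ^ n * H_form n (4 * (2 - s)) 1))
     (((2 - s) * z') ^ n * (2 ^ n * 0))"
    using z by (intro sqrt_i.scong_lmult) auto
  moreover have "((2 - s) * z') * (2 * (2 + s) * z) = 2 * ((2 - s) * (2 + s)) * (z * z')"
    by (simp only: mult_ac)
  then have "((2 - s) * z') * (2 * (2 + s) * z) = 8"
    unfolding z(4) by (simp add: algebra_simps sqrt3_mult)
  then have "((2 - s) * z') ^ n * (2 * (2 + s) * z) ^ n = 8 ^ n"
    by (simp only: flip: power_mult_distrib)
  ultimately show "sqrt_i.scong 3 (int p) (of_int (8 ^ n) * H_form n (4 * (2 - s)) 1) (of_int (8 ^ n) * 0)"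
    by (simp flip: mult.assoc)
  show "coprime (8 ^ n) (int p)"
    using coprime_2_3(1) coprime_power_left_iff[of 2 3 "int p"] by simp
  show "H_form n (4 * (2 - s)) 1 \<in> sqrt_i_ring 3" by auto
qed auto

lemma R_seq_closed: "of_int (R_seq k) = (2 + s) ^ k + (2 - s) ^ k"
proof (induction k rule: R_seq.induct)
  case (3 k)
  have "(2 + s) ^ Suc (Suc k) + (2 - s) ^ Suc (Suc k)
     = 4 * ((2 + s) ^ Suc k + (2 - s) ^ Suc k) - ((2 + s) ^ k + (2 - s) ^ k)"
    unfolding power_Suc by (simp add: algebra_simps sqrt3_mult)
  then show ?case unfolding 3[symmetric] by (simp add: algebra_simps)
qed simp_all

lemma R_seq_sum_dvd:
  "(int p)\<^sup>2 dvd (\<Sum>k\<le>n. int (n choose k) * E_coeff n k * ((-4) ^ k * R_seq k))"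
    (is "_ dvd ?N")
proof -
  define a b where "a = 2 + s" and "b = 2 - s"
  have ab: "a \<in> sqrt_i_ring 3" "b \<in> sqrt_i_ring 3" unfolding a_def b_def by auto
  have odd: "odd n" using half_mod_6 by presburger
  have "G_form n (-4 * a) 1 = G_form n (- (a\<^sup>2) * (-4 * b)) (- (a\<^sup>2) * 1)"
  proof -
    \<comment> \<open>From a^2 = 4a - 1 and ab = 1: for y = -4a, 1 + y = -a^2 and -y/(1+y) =
      -4b.\<close>
    have "- (-4 * a) = - (a\<^sup>2) * (-4 * b)" "-4 * a + 1 = - (a\<^sup>2) * 1"
      unfolding a_def b_def power2_eq_square by (simp_all add: algebra_simps sqrt3_mult)
    from this[symmetric] show ?thesis by (simp only: G_form_symmetry)
  qed
  also have "\<dots> = - (a ^ (2 * n)) * G_form n (-4 * b) 1"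
    \<comment> \<open>Odd n makes the factor negative, so the sum of the two values, not the
      difference, vanishes to second order.\<close>
    unfolding G_form_scale using odd by (simp add: power_mult)
  finally have G: "G_form n (-4 * a) 1 + G_form n (-4 * b) 1 = (1 - a ^ (2 * n)) * G_form n (-4 * b) 1"
    by (simp add: algebra_simps)
  have "of_int ?N = G_form n (-4 * a) 1 + G_form n (-4 * b) 1"
    unfolding G_form_def of_int_sum sum_distrib_left sum.distrib[symmetric]
  proof (intro sum.cong refl)
    fix k
    have "of_int (int (n choose k) * E_coeff n k * ((-4) ^ k * R_seq k))
       = of_nat (n choose k) * of_int (E_coeff n k) * (-4) ^ k * (of_int (R_seq k) :: complex)"
      by simp
    also have "\<dots> = of_nat (n choose k) * of_int (E_coeff n k) * (-4) ^ k * (a ^ k + b ^ k)"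
      unfolding R_seq_closed a_def b_def ..
    finally show "of_int (int (n choose k) * E_coeff n k * ((-4) ^ k * R_seq k))
       = of_nat (n choose k) * of_int (E_coeff n k) * (-4 * a) ^ k * 1 ^ (n - k)
       + of_nat (n choose k) * of_int (E_coeff n k) * (-4 * b) ^ k * 1 ^ (n - k)"
      unfolding power_mult_distrib by (simp add: algebra_simps)
  qed
  also note G
  also have "sqrt_i.scong 3 ((int p)\<^sup>2) ((1 - a ^ (2 * n)) * G_form n (-4 * b) 1) 0"
  proof (rule sqrt_i.scong_zero_mult)
    show "sqrt_i.scong 3 (int p) (1 - a ^ (2 * n)) 0"
      using sqrt_i.scong_diff[OF sqrt_i.scong_refl[of 3 "int p" 1] unit_power_sqrt3] by (simp add: a_def)
    have "sqrt_i.scong 3 (int p) (G_form n (-4 * b) 1) (of_int (fact n) * H_form n (- (-4 * b)) 1)"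
      using ab by (intro sqrt_i.G_form_scong p sqrt_i.mult sqrt_i.uminus) auto
    also have "- (-4 * b) = 4 * (2 - s)" by (simp add: b_def)
    also have "sqrt_i.scong 3 (int p) (of_int (fact n) * H_form n (4 * (2 - s)) 1) (of_int (fact n) * 0)"
      by (intro sqrt_i.scong_lmult H_form_sqrt3) (rule sqrt_i.of_int)
    finally show "sqrt_i.scong 3 (int p) (G_form n (-4 * b) 1) 0" by simp
  qed
  finally show ?thesis by (rule sqrt_i_scong_imp_dvd) simp
qed

end

subsection \<open>The exact cases and the transfer to rational sums\<close>

text \<open>y = -2 is fixed by y to -y/(1+y), and 1 + y = -1, so G(-2) = (-1)^n G(-2).\<close>

lemma odd_sum_zero:
  assumes "odd n"
  shows "(\<Sum>k\<le>n. int (n choose k) * E_coeff n k * (-2) ^ k) = 0"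
proof -
  have "G_form n (-2) 1 = G_form n (-1 * -2) (-1 * (1::int))"
    using G_form_symmetry[of n "-2" "1 :: int"] by simp
  also have "\<dots> = - G_form n (-2) 1"
    unfolding G_form_scale using assms by simp
  finally show ?thesis unfolding G_form_def by simp
qed

lemma chi3_conv: "chi3 k = (if k mod 3 = 0 then 0 else if k mod 3 = 1 then 1 else - 1)"
proof -
  have "[int k = 0] (mod 3) \<longleftrightarrow> k mod 3 = 0"
    unfolding cong_0_iff by presburger
  moreover have "QuadRes 3 (int k) \<longleftrightarrow> k mod 3 \<noteq> 2"
  proof -
    have sq: "y\<^sup>2 mod 3 = (y mod 3)\<^sup>2 mod 3" for y :: int by (simp add: power_mod)
    have "y\<^sup>2 mod 3 = 0 \<or> y\<^sup>2 mod 3 = 1" for y :: int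
    proof -
      have "y mod 3 = 0 \<or> y mod 3 = 1 \<or> y mod 3 = 2" by presburger
      then show ?thesis unfolding sq[of y] by (elim disjE) simp_all
    qed
    moreover have "int k mod 3 = 0 \<Longrightarrow> QuadRes 3 (int k)"
      unfolding QuadRes_def cong_def by (rule exI[of _ 0]) simp
    moreover have "int k mod 3 = 1 \<Longrightarrow> QuadRes 3 (int k)"
      unfolding QuadRes_def cong_def by (rule exI[of _ 1]) simp
    moreover have "int k mod 3 = 0 \<longleftrightarrow> k mod 3 = 0" "int k mod 3 = 1 \<longleftrightarrow> k mod 3 = 1" "k mod 3 < 3"
      by presburger+
    ultimately show ?thesis unfolding QuadRes_def cong_def
      by (metis QuadRes_def cong_def less_2_cases_iff less_Suc_eq numeral_3_eq_3 numeral_2_eq_2 One_nat_def n_not_Suc_n numeral_nat(7) zero_neq_numeral)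
  qed
  moreover have "k mod 3 = 0 \<or> k mod 3 = 1 \<or> k mod 3 = 2" by presburger
  ultimately show ?thesis unfolding chi3_def Legendre_def by auto
qed

text \<open>Let w be a primitive cube root of unity. Since 1 + w = -w^2, the symmetry exchanges w
  and w^2 with the factor (-w^2)^n = 1, and \<open>chi3 k\<close> is (w^k - w^(2k))/(w -
  w^2).\<close>

lemma chi3_sum_zero:
  assumes "6 dvd n"
  shows "(\<Sum>k\<le>n. int (n choose k) * E_coeff n k * chi3 k) = 0" (is "?N = 0")
proof -
  define w :: complex where "w = Complex (- 1 / 2) (sqrt 3 / 2)"
  have w2: "w * w = - 1 - w"
    unfolding w_def by (simp add: complex_eq_iff)
  then have w2': "w * (w * x) = (- 1 - w) * x" for x by (simp flip: mult.assoc)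
  obtain m where m: "n = 6 * m" using assms by auto
  have "- w = - (w\<^sup>2) * w\<^sup>2" "w + 1 = - (w\<^sup>2) * 1"
    by (simp_all add: power2_eq_square algebra_simps w2 w2')
  then have "G_form n w 1 = G_form n (- (w\<^sup>2) * w\<^sup>2) (- (w\<^sup>2) * 1)"
    using G_form_symmetry[of n w 1] by simp
  also have "\<dots> = (- (w\<^sup>2)) ^ n * G_form n (w\<^sup>2) 1"
    by (rule G_form_scale)
  also have "(- (w\<^sup>2)) ^ 6 = 1"
    by (simp add: eval_nat_numeral algebra_simps w2 w2')
  then have "(- (w\<^sup>2)) ^ n = 1" unfolding m power_mult by simp
  finally have G: "G_form n w 1 - G_form n (w\<^sup>2) 1 = 0" by simp
  have w3: "w ^ 3 = 1"
    by (simp add: eval_nat_numeral algebra_simps w2 w2')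
  have chi: "(w - w\<^sup>2) * of_int (chi3 k) = w ^ k - (w\<^sup>2) ^ k" for k
  proof -
    have red: "w ^ k = w ^ (k mod 3)" "(w\<^sup>2) ^ k = (w\<^sup>2) ^ (k mod 3)"
    proof -
      have "x ^ k = x ^ (k mod 3)" if "x ^ 3 = 1" for x :: complex
        using that by (metis div_mult_mod_eq mult.commute mult_1 power_add power_mult power_one)
      moreover have "(w\<^sup>2) ^ 3 = 1" using w3 by (metis power_mult mult.commute power_one)
      ultimately show "w ^ k = w ^ (k mod 3)" "(w\<^sup>2) ^ k = (w\<^sup>2) ^ (k mod 3)"
        using w3 by blast+
    qed
    have "k mod 3 = 0 \<or> k mod 3 = 1 \<or> k mod 3 = 2" by presburger
    then show ?thesis
      unfolding red chi3_conv by (elim disjE) (simp_all add: power2_eq_square algebra_simps w2 w2')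
  qed
  have "(w - w\<^sup>2) * of_int ?N = G_form n w 1 - G_form n (w\<^sup>2) 1"
    unfolding G_form_def of_int_sum sum_distrib_left sum_subtractf[symmetric]
  proof (intro sum.cong refl)
    fix k
    have "(w - w\<^sup>2) * of_int (int (n choose k) * E_coeff n k * chi3 k)
       = of_nat (n choose k) * of_int (E_coeff n k) * ((w - w\<^sup>2) * of_int (chi3 k))"
      by simp
    then show "(w - w\<^sup>2) * of_int (int (n choose k) * E_coeff n k * chi3 k)
       = of_nat (n choose k) * of_int (E_coeff n k) * w ^ k * 1 ^ (n - k)
       - of_nat (n choose k) * of_int (E_coeff n k) * (w\<^sup>2) ^ k * 1 ^ (n - k)"
      unfolding chi by (simp add: algebra_simps)
  qed
  moreover have "w - w\<^sup>2 \<noteq> 0"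
    unfolding power2_eq_square w2 by (simp add: w_def complex_eq_iff)
  ultimately have "complex_of_int ?N = 0" using G by (simp del: of_int_sum)
  then show ?thesis by (simp only: of_int_eq_0_iff)
qed

lemma prime_dvd_central_binomial:
  assumes "prime p" "k < p" "p \<le> 2 * k"
  shows "p dvd (2 * k) choose k"
proof -
  have "p dvd fact k * fact k * ((2 * k) choose k)"
    using binomial_fact_lemma[of k "2 * k"] assms by (simp add: prime_dvd_fact_iff)
  then show ?thesis
    using assms by (simp add: prime_dvd_mult_iff prime_dvd_fact_iff)
qed

text \<open>\<open>ce\<close> says that c k / D^k = e k / 16^k, which absorbs the power of 16 from
  \<open>E_coeff_cong_sq\<close> and reduces each case to one integer sum over k \<le> n.\<close>

lemma rat_cong_sqI:
  fixes c e :: "nat \<Rightarrow> int" and D :: int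
  assumes p: "prime p" "p = 2 * n + 1" and D: "coprime D (int p)"
    and ce: "\<And>k. 16 ^ k * c k = D ^ k * e k"
    and dvd: "(int p)\<^sup>2 dvd (\<Sum>k\<le>n. int (n choose k) * E_coeff n k * e k)"
  shows "rat_cong_sq p (\<Sum>k = 0..p - 1. of_nat ((p - 1) choose k) * of_nat ((2 * k) choose k) ^ 2
            * (of_int (c k) / of_int D ^ k)) 0"
proof -
  let ?t = "\<lambda>k. int ((2 * n) choose k) * (int ((2 * k) choose k))\<^sup>2"
  define r where "r = (\<Sum>k = 0..p - 1. of_nat ((p - 1) choose k) * of_nat ((2 * k) choose k) ^ 2
            * (of_int (c k) / of_int D ^ k) :: rat)"
  \<comment> \<open>The rational sum cleared by the common denominator D^(p-1).\<close>
  define Z where "Z = (\<Sum>k\<le>2 * n. ?t k * c k * D ^ (2 * n - k))"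
  have "prime (int p)" using p(1) by simp
  then have D0: "D \<noteq> 0" using D by (metis coprime_0_left_iff not_prime_unit)
  have rZ: "r * of_int D ^ (2 * n) = of_int Z"
    unfolding r_def Z_def of_int_sum sum_distrib_right p(2) add_diff_cancel_right' atMost_atLeast0
  proof (intro sum.cong refl)
    fix k assume "k \<in> {0..2 * n}"
    then have "(of_int D :: rat) ^ (2 * n) = of_int D ^ k * of_int D ^ (2 * n - k)"
      by (simp flip: power_add)
    then show "of_nat (2 * n choose k) * (of_nat (2 * k choose k))\<^sup>2 * (of_int (c k) / of_int D ^ k) * of_int D ^ (2 * n)
      = (of_int (?t k * c k * D ^ (2 * n - k)) :: rat)"
      using D0 by simp
  qed
  define M where "M = pochhammer (2 * int n + 2) n"
  have "coprime M (int p)"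
    unfolding M_def pochhammer_prod
  proof (rule prod_coprime_left)
    fix i assume "i \<in> {0..<n}"
    then have "coprime (int (Suc i)) (int p)"
      using coprime_Suc_less_prime[OF p(1), of i] p(2) by (simp add: add.commute)
    \<comment> \<open>The factors of \<open>M\<close> are p+1, ..., p+n.\<close>
    moreover have "2 * int n + 2 + int i = int (Suc i) + int p" using p(2) by simp
    ultimately show "coprime (2 * int n + 2 + of_nat i) (int p)"
      by (simp only: coprime_iff_gcd_eq_1 gcd_add1)
  qed
  moreover have "(int p)\<^sup>2 dvd M * Z"
  proof -
    have "[M * Z = (\<Sum>k\<le>2 * n. if k \<le> n then D ^ (2 * n) * (int (n choose k) * E_coeff n k * e k) else 0)] (mod (int p)\<^sup>2)"
      unfolding Z_def sum_distrib_left
    proof (rule cong_sum)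
      fix k assume k: "k \<in> {..2 * n}"
      show "[M * (?t k * c k * D ^ (2 * n - k))
        = (if k \<le> n then D ^ (2 * n) * (int (n choose k) * E_coeff n k * e k) else 0)] (mod (int p)\<^sup>2)"
      proof (cases "k \<le> n")
        case True
        have "M * (?t k * c k * D ^ (2 * n - k)) = (M * ?t k) * (c k * D ^ (2 * n - k))"
          by (simp only: mult_ac)
        also have "[\<dots> = 16 ^ k * (int (n choose k) * E_coeff n k) * (c k * D ^ (2 * n - k))] (mod (int p)\<^sup>2)"
          unfolding M_def by (intro cong_scalar_right E_coeff_cong_sq p True)
        also have "16 ^ k * (int (n choose k) * E_coeff n k) * (c k * D ^ (2 * n - k))
            = (D ^ k * D ^ (2 * n - k)) * (int (n choose k) * E_coeff n k * e k)"
          using ce[of k] by (simp add: mult_ac)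
        also have "D ^ k * D ^ (2 * n - k) = D ^ (2 * n)"
          using k by (simp flip: power_add)
        finally show ?thesis using True by simp
      next
        case False
        \<comment> \<open>For n < k < p the squared central binomial coefficient alone supplies
          p^2.\<close>
        then have "p dvd (2 * k) choose k"
          using k p by (intro prime_dvd_central_binomial) auto
        then have "(int p)\<^sup>2 dvd (int ((2 * k) choose k))\<^sup>2"
          by (intro dvd_power_same) simp
        then have "(int p)\<^sup>2 dvd M * (?t k * c k * D ^ (2 * n - k))"
          by (intro dvd_mult dvd_mult2)
        then show ?thesis using False by (simp add: cong_0_iff)
      qed
    qed
    also have "(\<Sum>k\<le>2 * n. if k \<le> n then D ^ (2 * n) * (int (n choose k) * E_coeff n k * e k) else 0)
        = D ^ (2 * n) * (\<Sum>k\<le>n. int (n choose k) * E_coeff n k * e k)"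
      unfolding sum_distrib_left by (rule sum.mono_neutral_cong_right) auto
    finally show ?thesis using dvd by (metis cong_dvd_iff dvd_mult)
  qed
  ultimately have Z: "(int p)\<^sup>2 dvd Z"
    by (metis coprime_commute coprime_dvd_mult_right_iff coprime_power_left_iff)
  obtain a b where ab: "quotient_of r = (a, b)" by fastforce
  have b: "b > 0" "coprime a b" "r = of_int a / of_int b"
    using quotient_of_denom_pos[OF ab] quotient_of_coprime[OF ab] quotient_of_div[OF ab] by auto
  have "rat_of_int (a * D ^ (2 * n)) = of_int (Z * b)"
    using rZ b by (simp add: field_simps)
  \<comment> \<open>In lowest terms b divides a power of D and so is prime to p, and the factor p^2
    of Z passes to the numerator a.\<close>
  then have eq: "a * D ^ (2 * n) = Z * b" by (simp only: of_int_eq_iff)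
  then have "b dvd a * D ^ (2 * n)" by simp
  then have "b dvd D ^ (2 * n)"
    using b(2) by (simp add: coprime_commute coprime_dvd_mult_right_iff)
  then have "coprime b (int p)"
    using D by (metis coprime_divisors coprime_power_left_iff dvd_refl)
  moreover have "(int p)\<^sup>2 dvd a * D ^ (2 * n)" using eq Z by simp
  then have "(int p)\<^sup>2 dvd a"
    using D by (metis coprime_commute coprime_dvd_mult_left_iff coprime_power_left_iff coprime_power_right_iff)
  ultimately have "rat_cong_sq p r 0"
    unfolding rat_cong_sq_def denom_prime_to_def using ab by (simp add: rat_zero_code)
  then show ?thesis unfolding r_def .
qed


theorem theorem1:
  fixes p :: nat
  assumes "prime p"
  shows
    "([p = 3] (mod 4) \<longrightarrow>
       rat_cong_sq p
         (\<Sum>k = 0..p - 1. of_nat ((p - 1) choose k) * of_nat ((2 * k) choose k) ^ 2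
            * (1 / (- 8) ^ k)) 0) \<and>
     ([p = 1] (mod 12) \<longrightarrow>
       rat_cong_sq p
         (\<Sum>k = 0..p - 1. of_nat ((p - 1) choose k) * of_nat ((2 * k) choose k) ^ 2
            * (of_int (chi3 k) / 16 ^ k)) 0) \<and>
     ([p = 7] (mod 8) \<longrightarrow>
       rat_cong_sq p
         (\<Sum>k = 0..p - 1. of_nat ((p - 1) choose k) * of_nat ((2 * k) choose k) ^ 2
            * (of_int (pell k) / 8 ^ k)) 0) \<and>
     ([p = 11] (mod 12) \<longrightarrow>
       rat_cong_sq p
         (\<Sum>k = 0..p - 1. of_nat ((p - 1) choose k) * of_nat ((2 * k) choose k) ^ 2
            * (of_int (R_seq k) / (- 4) ^ k)) 0)"
proof (intro conjI impI)
  define n where "n = p div 2"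
  have pn: "p = 2 * n + 1" if "odd p"
    using that unfolding n_def by simp
  have "coprime (2 ^ 4) (int p)" "coprime (2 ^ 3) (int p)" "coprime (- (2 ^ 3)) (int p)"
    "coprime (- (2 ^ 2)) (int p)" if "odd p"
    using that by (simp_all only: coprime_minus_left_iff coprime_power_left_iff coprime_left_2_iff_odd even_of_nat) simp_all
  then have cop: "coprime 16 (int p)" "coprime 8 (int p)" "coprime (-8) (int p)"
    "coprime (-4) (int p)" if "odd p"
    using that by simp_all
  \<comment> \<open>Instances of \<open>ce\<close> for D = -8, 8 and -4; the case D = 16 is
    reflexive.\<close>
  have pow16: "16 ^ k * 1 = (-8) ^ k * (-2 :: int) ^ k" "16 ^ k * a = 8 ^ k * (2 ^ k * a)"
    "16 ^ k * a = (-4) ^ k * ((-4) ^ k * a)" for k and a :: int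
    by (simp_all flip: power_mult_distrib mult.assoc)
  have dvd_zero: "(int p)\<^sup>2 dvd x" if "x = 0" for x
    using that by simp
  note of_int = of_int_numeral of_int_neg_numeral of_int_1
  {
    assume "[p = 3] (mod 4)"
    then obtain q where q: "p = 4 * q + 3"
      using mult_div_mod_eq[of 4 p] unfolding cong_def by (auto intro: that[of "p div 4"])
    then have "odd p" by simp
    moreover from pn[OF this] q have "n = 2 * q + 1" by simp
    ultimately have odd: "odd p" "odd n" by simp_all
    show "rat_cong_sq p
         (\<Sum>k = 0..p - 1. of_nat ((p - 1) choose k) * of_nat ((2 * k) choose k) ^ 2
            * (1 / (- 8) ^ k)) 0"
      using rat_cong_sqI[OF assms pn[OF odd(1)] cop(3)[OF odd(1)] pow16(1)
          dvd_zero[OF odd_sum_zero[OF odd(2)]]]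
      by (simp only: of_int)
  next
    assume "[p = 1] (mod 12)"
    then obtain q where q: "p = 12 * q + 1"
      using mult_div_mod_eq[of 12 p] unfolding cong_def by (auto intro: that[of "p div 12"])
    then have odd: "odd p" "6 dvd n" by (auto simp: n_def)
    show "rat_cong_sq p
         (\<Sum>k = 0..p - 1. of_nat ((p - 1) choose k) * of_nat ((2 * k) choose k) ^ 2
            * (of_int (chi3 k) / 16 ^ k)) 0"
      using rat_cong_sqI[OF assms pn[OF odd(1)] cop(1)[OF odd(1)] refl
          dvd_zero[OF chi3_sum_zero[OF odd(2)]]]
      by (simp only: of_int)
  next
    assume "[p = 7] (mod 8)"
    then obtain q where q: "p = 8 * q + 7"
      using mult_div_mod_eq[of 8 p] unfolding cong_def by (auto intro: that[of "p div 8"])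
    then have m: "p mod 8 = 7" and odd: "odd p" by auto
    show "rat_cong_sq p
         (\<Sum>k = 0..p - 1. of_nat ((p - 1) choose k) * of_nat ((2 * k) choose k) ^ 2
            * (of_int (pell k) / 8 ^ k)) 0"
      using rat_cong_sqI[OF assms pn[OF odd] cop(2)[OF odd] pow16(2)
          pell_sum_dvd[OF assms pn[OF odd] m refl]]
      by (simp only: of_int)
  next
    assume "[p = 11] (mod 12)"
    then obtain q where q: "p = 12 * q + 11"
      using mult_div_mod_eq[of 12 p] unfolding cong_def by (auto intro: that[of "p div 12"])
    then have m: "p mod 12 = 11" and odd: "odd p" by auto
    show "rat_cong_sq p
         (\<Sum>k = 0..p - 1. of_nat ((p - 1) choose k) * of_nat ((2 * k) choose k) ^ 2
            * (of_int (R_seq k) / (- 4) ^ k)) 0"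
      using rat_cong_sqI[OF assms pn[OF odd] cop(4)[OF odd] pow16(3)
          R_seq_sum_dvd[OF assms pn[OF odd] m refl]]
      by (simp only: of_int)
  }
qed

end
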